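(* Let $E=(d_1,\ldots,d_{m-1})$ be a valid ordered tuple and $d=d_1+\cdots+d_{m-1}$. Then a nonnegative integer belongs to the sequence $A_E$ if and only if its base $d+1$ representation contains only the digits $0$ and $1$.
   Context: An ordered tuple $E=(d_1,\ldots,d_{m-1})$ of positive integers is written in nondecreasing order $d_1\le\cdots\le d_{m-1}$; $d=d(E)=d_1+\cdots+d_{m-1}$. $E$ is valid if $d_1=1$ and $d_l\le d_1+\cdots+d_{l-1}$ for every $2\le l\le m-1$. The sequence $A_E$ of nonnegative integers is defined greedily: $a_0=0$, and having chosen $a_0,\ldots,a_k$, $a_{k+1}$ is the least integer greater than $a_k$ such that there are no $x_1,\ldots,x_m\in\{a_0,\ldots,a_{k+1}\}$, not all the same, with $d_1x_1+\cdots+d_{m-1}x_{m-1}=dx_m$. *)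

theory Defs
  imports Main
begin

text \<open>
  A tuple $E = (d_1,\ldots,d_{m-1})$ is a list, with $d_l$ stored at index $l - 1$; thus
  \<open>length E\<close> is $m - 1$, and $d = d(E)$ is \<open>sum_list E\<close>.
\<close>

definition ordered_tuple :: "nat list \<Rightarrow> bool" where
  "ordered_tuple E \<longleftrightarrow> sorted E \<and> (\<forall>c\<in>set E. 0 < c)"

definition valid_tuple :: "nat list \<Rightarrow> bool" where
  "valid_tuple E \<longleftrightarrow> E \<noteq> [] \<and> E ! 0 = 1 \<and>
     (\<forall>l. 1 \<le> l \<and> l < length E \<longrightarrow> E ! l \<le> (\<Sum>i<l. E ! i))"

text \<open>
  A nontrivial solution in \<open>S\<close> of $d_1 x_1 + \cdots + d_{m-1} x_{m-1} = d x_m$; the value $x_i$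
  is \<open>x (i - 1)\<close>, so that $x_m$ is \<open>x (length E)\<close>. Values of \<open>x\<close> beyond that index are irrelevant.
\<close>

definition has_nontrivial_solution :: "nat list \<Rightarrow> nat set \<Rightarrow> bool" where
  "has_nontrivial_solution E S \<longleftrightarrow>
     (\<exists>x :: nat \<Rightarrow> nat.
        (\<forall>i\<le>length E. x i \<in> S) \<and>
        (\<exists>i\<le>length E. \<exists>j\<le>length E. x i \<noteq> x j) \<and>
        (\<Sum>i<length E. E ! i * x i) = sum_list E * x (length E))"

text \<open>
  For positive coefficients every sufficiently large integer is admissible at each step, so
  the minimum below exists.
\<close>

fun greedy_seq :: "nat list \<Rightarrow> nat \<Rightarrow> nat" where
  "greedy_seq E 0 = 0"
| "greedy_seq E (Suc k) =
     (LEAST n. greedy_seq E k < n \<and>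
        \<not> has_nontrivial_solution E (insert n (set (map (greedy_seq E) [0..<Suc k]))))"

text \<open>Leading zeros, which occur for all large \<open>i\<close>, are harmless here.\<close>

definition digits_zero_one :: "nat \<Rightarrow> nat \<Rightarrow> bool" where
  "digits_zero_one b n \<longleftrightarrow> (\<forall>i. n div b ^ i mod b \<in> {0, 1})"

end

theory Submission
  imports Defs "HOL-Library.Infinite_Set"
begin

text \<open>
  Let \<open>b = d + 1\<close> and let \<open>S\<close> be the set of numbers with base-\<open>b\<close> digits \<open>0\<close> and \<open>1\<close>.
  For values in \<open>S\<close> the weighted sum produces no carries, so the equation holds digit by digit
  and forces all digits to agree; hence \<open>S\<close> has no nontrivial solution.
  Conversely, validity makes every \<open>c < d\<close> a subset sum of \<open>(d\<^sub>2, \<dots>, d\<^sub>m\<^sub>-\<^sub>1)\<close>. Given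
  \<open>n \<notin> S\<close>, one takes \<open>x\<^sub>1 = n\<close> and solves for the remaining \<open>x\<^sub>i\<close> digit by digit: a digit
  \<open>c \<ge> 2\<close> of \<open>n\<close> is balanced by giving \<open>x\<^sub>m\<close> the digit \<open>1\<close> and writing \<open>d - c\<close> as a subset
  sum. The \<open>x\<^sub>i\<close> lie in \<open>S\<close> below \<open>n\<close>, so the greedy procedure rejects exactly the \<open>n \<notin> S\<close>.
\<close>

section \<open>Subset sums\<close>

text \<open>Terms are chosen from the top down: if \<open>c\<close> exceeds the sum of the earlier
  terms, the growth condition gives \<open>f k <= c\<close>, so \<open>f k\<close> is used and the
  remainder is again within reach of the earlier terms.\<close>

lemma subset_sum_exists:
  fixes f :: "nat \<Rightarrow> nat"
  assumes "\<And>l. l < k \<Longrightarrow> f l \<le> 1 + (\<Sum>i<l. f i)" and "c \<le> (\<Sum>i<k. f i)"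
  shows "\<exists>y. (\<forall>i. y i \<le> (1::nat)) \<and> (\<Sum>i<k. f i * y i) = c"
  using assms
proof (induction k arbitrary: c)
  case 0
  then show ?case by (auto intro!: exI[of _ "\<lambda>_. 0"])
next
  case (Suc k)
  have extend: "\<exists>y. (\<forall>i. y i \<le> 1) \<and> (\<Sum>i<Suc k. f i * y i) = c"
    if c': "c' \<le> (\<Sum>i<k. f i)" "e \<le> 1" "c = c' + f k * e" for c' e
  proof -
    obtain y where y: "\<forall>i. y i \<le> (1::nat)" "(\<Sum>i<k. f i * y i) = c'"
      using Suc.IH[OF _ c'(1)] Suc.prems(1) by force
    have "(\<Sum>i<k. f i * (y(k := e)) i) = (\<Sum>i<k. f i * y i)"
      by (intro sum.cong) auto
    with y c' show ?thesis by (intro exI[of _ "y(k := e)"]) simp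
  qed
  show ?case
  proof (cases "c \<le> (\<Sum>i<k. f i)")
    case True
    then show ?thesis using extend[of c 0] by simp
  next
    case False
    with Suc.prems show ?thesis using extend[of "c - f k" 1] by force
  qed
qed

section \<open>Numbers with digits 0 and 1\<close>

lemma digits_zero_one_step:
  "digits_zero_one b n \<longleftrightarrow> n mod b \<in> {0, 1} \<and> digits_zero_one b (n div b)"
proof -
  have "(\<forall>i. P i) \<longleftrightarrow> P 0 \<and> (\<forall>i. P (Suc i))" for P :: "nat \<Rightarrow> bool"
    by (metis not0_implies_Suc)
  from this[of "\<lambda>i. n div b ^ i mod b \<in> {0, 1}"] show ?thesis
    by (simp add: digits_zero_one_def div_mult2_eq)
qed

lemma digits_zero_one_0: "digits_zero_one b 0"
  by (simp add: digits_zero_one_def)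

lemma digits_zero_one_append:
  assumes "digits_zero_one b q" "r \<le> 1" "1 < b"
  shows "digits_zero_one b (b * q + r)"
proof -
  have "r < b" "r \<in> {0, 1}" using assms by auto
  then show ?thesis
    using assms by (subst digits_zero_one_step) simp
qed

lemma infinite_digits_zero_one:
  assumes "1 < b"
  shows "infinite {n. digits_zero_one b n}"
proof -
  have "\<exists>n>m. digits_zero_one b n" for m
  proof (induction m)
    case 0
    show ?case using digits_zero_one_append[OF digits_zero_one_0, of 1 b] assms by auto
  next
    case (Suc m)
    then obtain n where n: "n > m" "digits_zero_one b n" by blast
    \<comment> \<open>Appending the digit 1 to a witness yields a strictly larger one.\<close>
    have "n < b * n + 1" using assms by (cases b) auto
    with n digits_zero_one_append[OF n(2), of 1] assms show ?case
      by (intro exI[of _ "b * n + 1"]) simp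
  qed
  then show ?thesis by (auto simp: infinite_nat_iff_unbounded)
qed

section \<open>Absence of nontrivial solutions\<close>

lemma weighted_digits_eq:
  fixes w y :: "nat \<Rightarrow> nat"
  assumes "\<And>i. i < k \<Longrightarrow> 0 < w i" "\<And>i. i \<le> k \<Longrightarrow> y i \<in> {0, 1}"
    and "(\<Sum>i<k. w i * y i) = (\<Sum>i<k. w i) * y k" and "j < k"
  shows "y j = y k"
proof (cases "y k = 0")
  case True
  with assms show ?thesis by force
next
  case False
  then have yk: "y k = 1" using assms(2)[of k] by auto
  \<comment> \<open>The complementary digits \<open>1 - y i\<close> then have weighted sum 0, and
    positive weights make each of them vanish.\<close>
  have "(\<Sum>i<k. w i * y i + w i * (1 - y i)) = (\<Sum>i<k. w i)"
  proof (rule sum.cong)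
    show "w i * y i + w i * (1 - y i) = w i" if "i \<in> {..<k}" for i
      using assms(2)[of i] that by auto
  qed simp
  then have "(\<Sum>i<k. w i * (1 - y i)) = 0"
    using assms(3) yk by (simp add: sum.distrib)
  then have "w j * (1 - y j) = 0" using assms(4) by simp
  then show ?thesis using assms(1)[of j] assms(2)[of j] assms(4) yk by auto
qed

text \<open>Strong induction on \<open>x k\<close>, stripping the last digit of every value: the
  equation splits into one for the last digits, settled by \<open>weighted_digits_eq\<close>, and
  one for the quotients.\<close>

lemma digits_zero_one_solution_trivial:
  fixes w x :: "nat \<Rightarrow> nat"
  assumes "\<And>i. i < k \<Longrightarrow> 0 < w i" "0 < k"
    and "b = (\<Sum>i<k. w i) + 1"
    and "\<And>i. i \<le> k \<Longrightarrow> digits_zero_one b (x i)"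
    and "(\<Sum>i<k. w i * x i) = (\<Sum>i<k. w i) * x k" and "j < k"
  shows "x j = x k"
  using assms(4-6)
proof (induction "x k" arbitrary: x j rule: less_induct)
  case less
  define d where "d = (\<Sum>i<k. w i)"
  have "w 0 \<le> d" unfolding d_def using assms(2) by (intro member_le_sum) auto
  then have b: "b = d + 1" "1 < b"
    using assms(1)[of 0] assms(2,3) by (auto simp: d_def)
  show ?case
  proof (cases "x k = 0")
    case True
    with less.prems(2,3) assms(1)[of j] show ?thesis by force
  next
    case False
    have dig: "x i mod b \<in> {0, 1}" "digits_zero_one b (x i div b)" if "i \<le> k" for i
      using less.prems(1)[OF that] by (auto simp: digits_zero_one_step[of b "x i"])
    have split_digit: "c * m = b * (c * (m div b)) + c * (m mod b)" for c m
      by (metis add_mult_distrib2 mult.left_commute mult_div_mod_eq)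
    define D where "D = (\<Sum>i<k. w i * (x i div b))"
    define M where "M = (\<Sum>i<k. w i * (x i mod b))"
    have "(\<Sum>i<k. w i * x i) = (\<Sum>i<k. b * (w i * (x i div b)) + w i * (x i mod b))"
      by (intro sum.cong split_digit refl)
    then have "b * D + M = d * x k"
      using less.prems(2) by (simp add: D_def M_def d_def sum.distrib sum_distrib_left)
    also have "\<dots> = b * (d * (x k div b)) + d * (x k mod b)"
      by (rule split_digit)
    finally have eq: "b * D + M = b * (d * (x k div b)) + d * (x k mod b)" .
    have "x i mod b \<le> 1" if "i \<le> k" for i
      using dig(1)[OF that] by auto
    then have "M \<le> (\<Sum>i<k. w i * 1)"
      unfolding M_def by (intro sum_mono mult_le_mono) auto
    then have "M < b" using b by (simp add: d_def)
    moreover have "d * (x k mod b) < b" using dig(1)[of k] b by auto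
    \<comment> \<open>No carry occurs: both sides of \<open>eq\<close> have a remainder part below
      \<open>b\<close>, so division by \<open>b\<close> separates them uniquely.\<close>
    ultimately have M: "M = d * (x k mod b)" and D: "D = d * (x k div b)"
      using b(2) arg_cong[OF eq, of "\<lambda>t. t mod b"]
        arg_cong[OF eq, of "\<lambda>t. t div b"]
      by simp_all
    have "x j mod b = x k mod b"
      using weighted_digits_eq[of k w "\<lambda>i. x i mod b" j] assms(1) dig(1) M less.prems(3)
      by (simp add: M_def d_def)
    moreover have "x j div b = x k div b"
      using less.hyps[of "\<lambda>i. x i div b" j] dig(2) D less.prems(3) False b
      by (simp add: D_def d_def)
    ultimately show ?thesis by (metis mult_div_mod_eq)
  qed
qed

section \<open>Solutions that exclude all other numbers\<close>

text \<open>This solves the equation for a single digit \<open>r\<close> at index 0, whose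
  coefficient is 1. The bound \<open>y i <= r\<close> later keeps the assembled values at most
  \<open>n\<close>; for \<open>r = 0\<close> it forces the constant solution.\<close>

lemma valid_tuple_digit_solution:
  assumes "valid_tuple E" "r \<le> sum_list E"
  shows "\<exists>y. y 0 = r \<and> (\<forall>i\<in>{1..length E}. y i \<le> 1 \<and> y i \<le> r) \<and>
    (\<Sum>i<length E. E ! i * y i) = sum_list E * y (length E)"
proof -
  obtain k where k: "length E = Suc k" using assms(1) by (cases E) (auto simp: valid_tuple_def)
  have E0: "E ! 0 = 1" using assms(1) by (simp add: valid_tuple_def)
  have d: "sum_list E = 1 + (\<Sum>i<k. E ! Suc i)"
    using E0 by (simp add: sum_list_sum_nth atLeast0LessThan k sum.lessThan_Suc_shift del: sum.lessThan_Suc)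
  have split: "(\<Sum>i<length E. E ! i * y i) = y 0 + (\<Sum>i<k. E ! Suc i * y (Suc i))" for y
    by (simp add: k sum.lessThan_Suc_shift E0 del: sum.lessThan_Suc)
  show ?thesis
  proof (cases "r \<le> 1")
    case True
    then show ?thesis
      by (intro exI[of _ "\<lambda>_. r"]) (simp add: sum_list_sum_nth atLeast0LessThan flip: sum_distrib_right)
  next
    case False
    have "E ! Suc l \<le> 1 + (\<Sum>i<l. E ! Suc i)" if "l < k" for l
    proof -
      have "E ! Suc l \<le> (\<Sum>i<Suc l. E ! i)"
        using assms(1) that k unfolding valid_tuple_def by fastforce
      then show ?thesis by (simp add: sum.lessThan_Suc_shift E0 del: sum.lessThan_Suc)
    qed
    moreover have "sum_list E - r \<le> (\<Sum>i<k. E ! Suc i)" using d False by simp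
    ultimately obtain z where
      z: "\<And>i. z i \<le> (1::nat)" "(\<Sum>i<k. E ! Suc i * z i) = sum_list E - r"
      using subset_sum_exists[of k "\<lambda>i. E ! Suc i"] by blast
    \<comment> \<open>Index \<open>Suc k\<close> is the right-hand variable. The shift in
      \<open>z (i - 1)\<close> reflects that \<open>z\<close> selects among the coefficients after
      the first.\<close>
    define y where "y i = (if i = 0 then r else if i = Suc k then 1 else z (i - 1))" for i
    have "(\<Sum>i<k. E ! Suc i * y (Suc i)) = (\<Sum>i<k. E ! Suc i * z i)"
      by (intro sum.cong) (auto simp: y_def)
    then have "(\<Sum>i<length E. E ! i * y i) = sum_list E * y (length E)"
      using assms(2) z(2) unfolding split by (simp add: y_def k)
    moreover have "y i \<le> 1 \<and> y i \<le> r" if "i \<in> {1..length E}" for i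
      using that z(1)[of "i - 1"] False by (auto simp: y_def)
    ultimately show ?thesis by (intro exI[of _ y]) (simp add: y_def)
  qed
qed

text \<open>By linearity, a solution for \<open>n div b\<close> scaled by \<open>b\<close> plus a
  digit solution for \<open>n mod b\<close> is a solution for \<open>n\<close>.\<close>

lemma valid_tuple_solution_below:
  assumes "valid_tuple E" "b = sum_list E + 1" "1 < b"
  shows "\<exists>x. x 0 = n \<and> (\<forall>i\<in>{1..length E}. digits_zero_one b (x i) \<and> x i \<le> n) \<and>
    (\<Sum>i<length E. E ! i * x i) = sum_list E * x (length E)"
proof (induction n rule: less_induct)
  case (less n)
  show ?case
  proof (cases "n = 0")
    case True
    then show ?thesis by (intro exI[of _ "\<lambda>_. 0"]) (simp add: digits_zero_one_0)
  next
    case False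
    then have "n div b < n" using assms(3) by simp
    from less.IH[OF this] obtain x where x: "x 0 = n div b"
      "\<And>i. i \<in> {1..length E} \<Longrightarrow> digits_zero_one b (x i) \<and> x i \<le> n div b"
      "(\<Sum>i<length E. E ! i * x i) = sum_list E * x (length E)"
      by blast
    have "n mod b < b" using assms(3) by simp
    then have "n mod b \<le> sum_list E" using assms(2) by simp
    from valid_tuple_digit_solution[OF assms(1) this] obtain y where y: "y 0 = n mod b"
      "\<And>i. i \<in> {1..length E} \<Longrightarrow> y i \<le> 1 \<and> y i \<le> n mod b"
      "(\<Sum>i<length E. E ! i * y i) = sum_list E * y (length E)"
      by blast
    have "(\<Sum>i<length E. E ! i * (b * x i + y i)) =
        b * (\<Sum>i<length E. E ! i * x i) + (\<Sum>i<length E. E ! i * y i)"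
      by (simp add: algebra_simps sum.distrib sum_distrib_left)
    also have "\<dots> = sum_list E * (b * x (length E) + y (length E))"
      unfolding x(3) y(3) by (simp add: algebra_simps)
    finally have "(\<Sum>i<length E. E ! i * (b * x i + y i)) =
      sum_list E * (b * x (length E) + y (length E))" .
    moreover have "digits_zero_one b (b * x i + y i) \<and> b * x i + y i \<le> n"
      if "i \<in> {1..length E}" for i
    proof -
      have "b * x i + y i \<le> b * (n div b) + n mod b"
        using x(2)[OF that] y(2)[OF that] by (intro add_mono mult_le_mono) auto
      then show ?thesis
        using x(2)[OF that] y(2)[OF that] assms(3) by (simp add: digits_zero_one_append)
    qed
    ultimately show ?thesis
      using x(1) y(1) by (intro exI[of _ "\<lambda>i. b * x i + y i"]) simp
  qed
qed

section \<open>Greedy sequences as enumerations\<close>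

lemma has_nontrivial_solution_mono:
  "has_nontrivial_solution E A \<Longrightarrow> A \<subseteq> B \<Longrightarrow> has_nontrivial_solution E B"
  unfolding has_nontrivial_solution_def by blast

text \<open>Members of \<open>S\<close> are never rejected, as \<open>S\<close> is free of
  nontrivial solutions, while any skipped non-member is rejected because all members of
  \<open>S\<close> below it have already been chosen.\<close>

lemma greedy_seq_eq_enumerate:
  assumes "infinite S" "0 \<in> S" "\<not> has_nontrivial_solution E S"
    and reject: "\<And>n. n \<notin> S \<Longrightarrow> has_nontrivial_solution E (insert n (S \<inter> {..<n}))"
  shows "greedy_seq E k = enumerate S k"
proof (induction k rule: less_induct)
  case (less k)
  show ?case
  proof (cases k)
    case 0
    have "enumerate S 0 = 0" using assms(2) by (simp add: enumerate_0 Least_equality)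
    with 0 show ?thesis by simp
  next
    case (Suc m)
    define T where "T = set (map (greedy_seq E) [0..<Suc m])"
    have gm: "greedy_seq E m = enumerate S m" using less Suc by simp
    have T: "T = enumerate S ` {..m}"
      unfolding T_def set_map using less Suc
      by (intro image_cong) (auto simp del: upt_Suc)
    have TS: "T \<subseteq> S" unfolding T using assms(1) by (auto intro: enumerate_in_set)
    have next_in: "enumerate S k \<in> S" by (rule enumerate_in_set[OF assms(1)])
    have between: "enumerate S k \<le> n"
      if "enumerate S m < n" "\<not> has_nontrivial_solution E (insert n T)" for n
    proof (rule ccontr)
      assume less_k: "\<not> enumerate S k \<le> n"
      \<comment> \<open>As \<open>n\<close> lies below the term of index \<open>k = Suc m\<close>,
        members of \<open>S\<close> below \<open>n\<close> have index at most
        \<open>m\<close>.\<close>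
      have "S \<inter> {..<n} \<subseteq> T"
      proof
        fix s assume s: "s \<in> S \<inter> {..<n}"
        then obtain j where j: "s = enumerate S j"
          using enumerate_Ex[OF assms(1)] by blast
        then have "enumerate S j < enumerate S k" using s less_k by simp
        then show "s \<in> T" unfolding T j using assms(1) Suc by simp
      qed
      then have "n \<in> S"
        using reject[of n] that(2) has_nontrivial_solution_mono[of E _ "insert n T"] by blast
      then obtain j where "n = enumerate S j" using enumerate_Ex[OF assms(1)] by blast
      with that(1) less_k assms(1) Suc show False by simp
    qed
    have "(LEAST n. enumerate S m < n \<and> \<not> has_nontrivial_solution E (insert n T)) = enumerate S k"
    proof (rule Least_equality)
      have "\<not> has_nontrivial_solution E (insert (enumerate S k) T)"
        using assms(3) next_in TS has_nontrivial_solution_mono by blast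
      then show "enumerate S m < enumerate S k \<and>
          \<not> has_nontrivial_solution E (insert (enumerate S k) T)"
        using assms(1) Suc by simp
    qed (use between in blast)
    then show ?thesis unfolding Suc T_def gm[symmetric] greedy_seq.simps .
  qed
qed

theorem theorem2:
  fixes E :: "nat list" and n :: nat
  assumes "ordered_tuple E" and "valid_tuple E"
  shows "n \<in> range (greedy_seq E) \<longleftrightarrow> digits_zero_one (sum_list E + 1) n"
proof -
  define b where "b = sum_list E + 1"
  define S where "S = {n. digits_zero_one b n}"
  have pos: "\<And>i. i < length E \<Longrightarrow> 0 < E ! i" and len: "0 < length E"
    using assms by (auto simp: ordered_tuple_def valid_tuple_def)
  have d: "sum_list E = (\<Sum>i<length E. E ! i)"
    by (simp add: sum_list_sum_nth atLeast0LessThan)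
  have "E ! 0 \<le> sum_list E" using len by (intro member_le_sum_list) auto
  then have b1: "1 < b" using pos[OF len] by (simp add: b_def)
  have inf: "infinite S" unfolding S_def by (rule infinite_digits_zero_one[OF b1])
  have "\<not> has_nontrivial_solution E S"
  proof
    assume "has_nontrivial_solution E S"
    then obtain x i j where x: "\<And>i. i \<le> length E \<Longrightarrow> digits_zero_one b (x i)"
      "(\<Sum>i<length E. E ! i * x i) = sum_list E * x (length E)"
      and ij: "i \<le> length E" "j \<le> length E" "x i \<noteq> x j"
      unfolding has_nontrivial_solution_def S_def by blast
    have "x l = x (length E)" if "l \<le> length E" for l
      using digits_zero_one_solution_trivial[of "length E" "(!) E" b x l] pos len x that
      by (cases "l = length E") (auto simp: b_def d)
    with ij show False by metis
  qed
  moreover have "has_nontrivial_solution E (insert n (S \<inter> {..<n}))" if n: "n \<notin> S" for n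
  proof -
    obtain x where x: "x 0 = n"
      "\<And>i. i \<in> {1..length E} \<Longrightarrow> digits_zero_one b (x i) \<and> x i \<le> n"
      "(\<Sum>i<length E. E ! i * x i) = sum_list E * x (length E)"
      using valid_tuple_solution_below[OF assms(2) b_def b1] by blast
    \<comment> \<open>Since \<open>n\<close> is not in \<open>S\<close>, the bound
      \<open>x i <= n\<close> is strict; this also makes the solution nontrivial, because
      \<open>x 0 = n\<close>.\<close>
    have below: "x i \<in> S \<inter> {..<n}" if "i \<in> {1..length E}" for i
      using x(2)[OF that] n by (auto simp: S_def order.order_iff_strict)
    then have "x i \<in> insert n (S \<inter> {..<n})" if "i \<le> length E" for i
      using that x(1) by (cases "i = 0") auto
    moreover have "x 0 \<noteq> x (length E)" using below[of "length E"] len x(1) by auto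
    ultimately show ?thesis
      unfolding has_nontrivial_solution_def using x(3) by blast
  qed
  moreover have "0 \<in> S" by (simp add: S_def digits_zero_one_0)
  ultimately have "greedy_seq E = enumerate S"
    using greedy_seq_eq_enumerate[OF inf] by blast
  then show ?thesis
    using range_enumerate[OF inf] by (simp add: S_def b_def)
qed

end
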